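(* Let $E_T(n)$ denote the expected value of the rank of a random vertex in a (uniformly random) unlabeled rooted plane tree of size $n$. Then, as $n\to\infty$, $$E_T(n)\sim \sum_{k=1}^\infty \frac{3}{4^k+2}\approx 0.727649,$$ where $\approx$ gives the value of the sum rounded to six decimal places.
   Context: A tree means an unlabeled rooted plane tree (a finite rooted tree with at least one vertex in which the children of every vertex are linearly ordered), counted up to isomorphism; its size is its number of vertices. The tree is chosen uniformly among all trees of size $n$ and the vertex uniformly among its $n$ vertices; equivalently, the pair (tree, vertex) is uniform among all such pairs. A leaf is a vertex with no children (so the root of the one-vertex tree is a leaf). The rank of a vertex is the length (number of edges) of a shortest downward path (parent to child steps) from the vertex to a leaf; leaves have rank $0$. Write $a_n\sim b_n$ if $\lim_{n\to\infty} a_n/b_n=1$. *)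

theory Defs
  imports "HOL-Probability.Probability" "HOL-Library.Landau_Symbols"
begin

text \<open>
  Isomorphism classes of rooted plane trees correspond exactly to values of this datatype:
  a tree is its root together with the linearly ordered list of the subtrees at its children.
\<close>

datatype plane_tree = Node "plane_tree list"

text \<open>
  A vertex is represented by its address: the list of child indices (counted from 0)
  leading to it from the root, which has the address \<^term>\<open>[]\<close>.
\<close>

lemma size_nth_less [termination_simp]:
  "i < length ts \<Longrightarrow> size (ts ! i) < Suc (size_list size ts)"
  by (meson le_imp_less_Suc nth_mem order.refl size_list_estimation')

fun vertices :: "plane_tree \<Rightarrow> nat list set" where
  "vertices (Node ts) = insert [] (\<Union>i\<in>{..<length ts}. (#) i ` vertices (ts ! i))"

definition child_rel :: "plane_tree \<Rightarrow> (nat list \<times> nat list) set" where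
  "child_rel t = {(v, w). v \<in> vertices t \<and> w \<in> vertices t \<and> (\<exists>i. w = v @ [i])}"

definition is_leaf :: "plane_tree \<Rightarrow> nat list \<Rightarrow> bool" where
  "is_leaf t v \<longleftrightarrow> v \<in> vertices t \<and> (\<nexists>w. (v, w) \<in> child_rel t)"

definition vertex_rank :: "plane_tree \<Rightarrow> nat list \<Rightarrow> nat" where
  "vertex_rank t v = (LEAST k. \<exists>w. is_leaf t w \<and> (v, w) \<in> child_rel t ^^ k)"

definition tree_size :: "plane_tree \<Rightarrow> nat" where
  "tree_size t = card (vertices t)"

definition trees :: "nat \<Rightarrow> plane_tree set" where
  "trees n = {t. tree_size t = n}"

definition random_rank :: "nat \<Rightarrow> nat pmf" where
  "random_rank n = do {
     t \<leftarrow> pmf_of_set (trees n);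
     v \<leftarrow> pmf_of_set (vertices t);
     return_pmf (vertex_rank t v)
   }"

definition E_T :: "nat \<Rightarrow> real" where
  "E_T n = measure_pmf.expectation (random_rank n) real"


lemma Nil_in_vertices: "[] \<in> vertices t"
  by (cases t) simp

lemma finite_vertices: "finite (vertices t)"
  by (induction t rule: vertices.induct) auto

lemma tree_size_Node: "tree_size (Node ts) = Suc (\<Sum>t\<leftarrow>ts. tree_size t)"
proof -
  have "card (\<Union>i\<in>{..<length ts}. (#) i ` vertices (ts ! i))
      = (\<Sum>i<length ts. card ((#) i ` vertices (ts ! i)))"
    by (rule card_UN_disjoint) (auto simp: finite_vertices)
  also have "\<dots> = (\<Sum>i<length ts. tree_size (ts ! i))"
    by (simp add: card_image tree_size_def)
  also have "\<dots> = (\<Sum>t\<leftarrow>ts. tree_size t)"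
    by (simp add: sum_list_sum_nth atLeast0LessThan)
  finally show ?thesis
    by (subst tree_size_def, simp, subst card_insert_disjoint) (auto simp: finite_vertices)
qed

lemma tree_size_pos: "tree_size t > 0"
  by (cases t) (simp add: tree_size_Node)

text \<open>
  For \<open>n > 0\<close> and every tree \<open>t\<close> the sets below are finite and nonempty, so that
  \<^const>\<open>pmf_of_set\<close> is the uniform distribution on them; for \<open>n = 0\<close> there are no trees
  and the value \<open>E_T 0\<close> is unspecified.
\<close>

lemma finite_trees: "finite (trees n)"
proof (induction n rule: less_induct)
  case (less n)
  let ?A = "\<Union>m<n. trees m"
  have "trees n \<subseteq> Node ` {ts. set ts \<subseteq> ?A \<and> length ts \<le> n}"
  proof
    fix t assume t: "t \<in> trees n"
    obtain ts where ts: "t = Node ts" by (cases t)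
    have n: "n = Suc (\<Sum>s\<leftarrow>ts. tree_size s)"
      using t by (simp add: trees_def ts tree_size_Node)
    have "tree_size s < n" if "s \<in> set ts" for s
      using member_le_sum_list[of "tree_size s" "map tree_size ts"] that n by auto
    moreover have "length ts \<le> (\<Sum>s\<leftarrow>ts. tree_size s)"
    proof (induction ts)
      case (Cons a ts)
      then show ?case using tree_size_pos[of a] by simp
    qed simp
    ultimately show "t \<in> Node ` {ts. set ts \<subseteq> ?A \<and> length ts \<le> n}"
      using n by (auto simp: ts trees_def)
  qed
  moreover have "finite {ts. set ts \<subseteq> ?A \<and> length ts \<le> n}"
    by (intro finite_lists_length_le) (use less in auto)
  ultimately show ?case
    using finite_subset by blast
qed

lemma trees_nonempty: "n > 0 \<Longrightarrow> trees n \<noteq> {}"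
proof -
  assume "n > 0"
  then have "Node (replicate (n - 1) (Node [])) \<in> trees n"
    by (simp add: trees_def tree_size_Node sum_list_replicate)
  then show ?thesis by blast
qed

text \<open>Every vertex has a leaf below it, so the \<open>LEAST\<close> in \<^const>\<open>vertex_rank\<close> is attained.\<close>

lemma vertex_rank_attained:
  assumes "v \<in> vertices t"
  shows "\<exists>w. is_leaf t w \<and> (v, w) \<in> child_rel t ^^ vertex_rank t v"
proof -
  have "\<exists>w k. is_leaf t w \<and> (v, w) \<in> child_rel t ^^ k"
    using assms
  proof (induction "Max (length ` vertices t) - length v" arbitrary: v rule: less_induct)
    case less
    show ?case
    proof (cases "is_leaf t v")
      case True
      then show ?thesis by (intro exI[of _ v] exI[of _ 0]) auto
    next
      case False
      then obtain u where u: "(v, u) \<in> child_rel t"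
        using less.prems by (auto simp: is_leaf_def)
      then have "u \<in> vertices t" "length u = Suc (length v)"
        by (auto simp: child_rel_def)
      moreover from this have "length u \<le> Max (length ` vertices t)"
        by (intro Max_ge finite_imageI finite_vertices imageI)
      ultimately have "u \<in> vertices t"
        "Max (length ` vertices t) - length u < Max (length ` vertices t) - length v"
        by linarith+
      then obtain w k where "is_leaf t w" "(u, w) \<in> child_rel t ^^ k"
        using less.hyps[of u] by blast
      then show ?thesis using u relpow_Suc_I2 by metis
    qed
  qed
  then have "\<exists>k w. is_leaf t w \<and> (v, w) \<in> child_rel t ^^ k" by blast
  then show ?thesis unfolding vertex_rank_def by (rule LeastI_ex)
qed

end

theory Submission
  imports Defs "HOL-Real_Asymp.Real_Asymp"
begin

text \<open>
  The rank of a vertex depends only on the fringe subtree hanging from it. Let \<open>T = z + T\<^sup>2\<close> be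
  the series of all trees and \<open>P\<close> the series of a class of trees. The series counting
  pairs of a tree and a vertex whose fringe subtree lies in the class is
  \<open>P (1 + U) / 2\<close> with \<open>U = 1 / (1 - 2 T) = (1 - 4 z)\<^bsup>-1/2\<^esup>\<close>, and that counting all pairs is \<open>z U\<close>.
  As the coefficients of \<open>U\<close> have ratio tending to \<open>4\<close>, the probability that a random fringe
  subtree lies in the class tends to \<open>2 P(1/4)\<close>; no mass escapes because \<open>2 T(1/4) = 1\<close>.
  For rank at least \<open>k\<close> the series satisfy \<open>R\<^bsub>k+1\<^esub> = z R\<^sub>k / (1 - R\<^sub>k)\<close>, whence
  \<open>2 R\<^sub>k(1/4) = 3 / (4\<^sup>k + 2)\<close>. Summation over \<open>k\<close> commutes with the limit since a vertex of rank at
  least \<open>k\<close> has a leftmost downward path of length at least \<open>k\<close>, which has probability at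
  most \<open>2\<^bsup>-k\<^esup>\<close> for every size.
\<close>

section \<open>Generating functions over trees\<close>

definition tree_gf :: "(plane_tree \<Rightarrow> real) \<Rightarrow> real fps" where
  "tree_gf g = Abs_fps (\<lambda>n. \<Sum>t\<in>trees n. g t)"

lemma tree_gf_nth: "fps_nth (tree_gf g) n = (\<Sum>t\<in>trees n. g t)"
  by (simp add: tree_gf_def)

lemma trees_0 [simp]: "trees 0 = {}"
  using tree_size_pos by (auto simp: trees_def)

lemma tree_gf_nth_0 [simp]: "fps_nth (tree_gf g) 0 = 0"
  by (simp add: tree_gf_nth)

lemma tree_gf_add: "tree_gf (\<lambda>t. g t + h t) = tree_gf g + tree_gf h"
  by (simp add: fps_eq_iff tree_gf_nth sum.distrib)

text \<open>Splitting off the leftmost subtree at the root gives \<open>T = z + T\<^sup>2\<close> without any series for forests.\<close>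

fun graft :: "plane_tree \<Rightarrow> plane_tree \<Rightarrow> plane_tree" where
  "graft t (Node ts) = Node (t # ts)"

lemma graft_inject: "graft t u = graft t' u' \<longleftrightarrow> t = t' \<and> u = u'"
  by (cases u; cases u') auto

lemma graft_neq_leaf: "graft t u \<noteq> Node []"
  by (cases u) auto

lemma tree_size_graft: "tree_size (graft t u) = tree_size t + tree_size u"
  by (cases u) (simp add: tree_size_Node)

lemma plane_tree_graft_cases:
  obtains "s = Node []" | t u where "s = graft t u"
proof (cases s)
  case (Node ts)
  then show ?thesis
    by (cases ts) (use that graft.simps in metis)+
qed

text \<open>The size \<open>i\<close> is determined by \<open>t\<close>; carrying it as an index
  turns a sum over grafts into a Cauchy product.\<close>

lemma graft_bij_betw:
  "bij_betw (\<lambda>(i, t, u). graft t u) (SIGMA i:{0..n}. trees i \<times> trees (n - i))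
     (trees n - {Node []})"
  unfolding bij_betw_def
proof (intro conjI equalityI)
  show "inj_on (\<lambda>(i, t, u). graft t u) (SIGMA i:{0..n}. trees i \<times> trees (n - i))"
    by (auto simp: inj_on_def graft_inject trees_def)
  show "(\<lambda>(i, t, u). graft t u) ` (SIGMA i:{0..n}. trees i \<times> trees (n - i))
      \<subseteq> trees n - {Node []}"
    by (auto simp: trees_def tree_size_graft graft_neq_leaf)
  show "trees n - {Node []}
      \<subseteq> (\<lambda>(i, t, u). graft t u) ` (SIGMA i:{0..n}. trees i \<times> trees (n - i))"
  proof
    fix s assume s: "s \<in> trees n - {Node []}"
    then obtain t u where tu: "s = graft t u"
      by (metis DiffE plane_tree_graft_cases singletonI)
    with s have "(tree_size t, t, u) \<in> (SIGMA i:{0..n}. trees i \<times> trees (n - i))"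
      by (auto simp: trees_def tree_size_graft)
    then show "s \<in> (\<lambda>(i, t, u). graft t u) ` (SIGMA i:{0..n}. trees i \<times> trees (n - i))"
      using tu by (intro image_eqI[of _ _ "(tree_size t, t, u)"]) auto
  qed
qed

text \<open>Two product terms are allowed because additive statistics split over a graft as a part
  from \<open>t\<close> plus a part from \<open>u\<close>. The one-vertex tree is the only non-graft
  and supplies the \<open>fps_X\<close> term.\<close>

lemma tree_gf_graft:
  assumes "\<And>t u. h (graft t u) = a t * b u + c t * d u"
  shows "tree_gf h = fps_const (h (Node [])) * fps_X + tree_gf a * tree_gf b + tree_gf c * tree_gf d"
proof (rule fps_ext)
  fix n
  have leaf: "(\<Sum>t\<in>trees n \<inter> {Node []}. h t) = fps_nth (fps_const (h (Node [])) * fps_X) n"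
    by (cases "n = 1") (auto simp: trees_def tree_size_Node Int_def cong: conj_cong)
  have "(\<Sum>t\<in>trees n - {Node []}. h t)
      = (\<Sum>(i, t, u)\<in>(SIGMA i:{0..n}. trees i \<times> trees (n - i)). h (graft t u))"
    by (subst sum.reindex_bij_betw[OF graft_bij_betw, symmetric]) (simp add: case_prod_unfold)
  also have "\<dots> = (\<Sum>i=0..n. \<Sum>(t, u)\<in>trees i \<times> trees (n - i). a t * b u + c t * d u)"
    by (subst sum.Sigma) (auto simp: finite_trees assms)
  also have "\<dots> = (\<Sum>i=0..n. (\<Sum>t\<in>trees i. a t) * (\<Sum>u\<in>trees (n - i). b u))
      + (\<Sum>i=0..n. (\<Sum>t\<in>trees i. c t) * (\<Sum>u\<in>trees (n - i). d u))"
    by (simp add: case_prod_unfold sum.distrib sum_product sum.cartesian_product)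
  also have "\<dots> = fps_nth (tree_gf a * tree_gf b + tree_gf c * tree_gf d) n"
    by (simp add: fps_mult_nth tree_gf_nth)
  finally have "(\<Sum>t\<in>trees n - {Node []}. h t)
      = fps_nth (tree_gf a * tree_gf b + tree_gf c * tree_gf d) n" .
  moreover have "(\<Sum>t\<in>trees n. h t)
      = (\<Sum>t\<in>trees n \<inter> {Node []}. h t) + (\<Sum>t\<in>trees n - {Node []}. h t)"
    by (rule sum.Int_Diff) (rule finite_trees)
  ultimately show "fps_nth (tree_gf h) n = fps_nth (fps_const (h (Node [])) * fps_X
      + tree_gf a * tree_gf b + tree_gf c * tree_gf d) n"
    using leaf by (simp add: tree_gf_nth)
qed

lemma tree_gf_graft_prod:
  assumes "\<And>t u. h (graft t u) = a t * b u"
  shows "tree_gf h = fps_const (h (Node [])) * fps_X + tree_gf a * tree_gf b"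
  using tree_gf_graft[of h a b "\<lambda>_. 0" "\<lambda>_. 0"] assms
  by (simp add: tree_gf_def fps_zero_def[symmetric])

section \<open>Fringe subtrees\<close>

fun subtree :: "plane_tree \<Rightarrow> nat list \<Rightarrow> plane_tree" where
  "subtree t [] = t"
| "subtree (Node ts) (i # v) = subtree (ts ! i) v"

text \<open>Children extend an address at its end, while \<open>vertices\<close> and
  \<open>subtree\<close> recurse from its front; induction on the address reconciles the
  two.\<close>

lemma subtree_snoc:
  assumes "v \<in> vertices t" "subtree t v = Node ss"
  shows "v @ [i] \<in> vertices t \<longleftrightarrow> i < length ss"
    and "i < length ss \<Longrightarrow> subtree t (v @ [i]) = ss ! i"
proof -
  have "(v @ [i] \<in> vertices t \<longleftrightarrow> i < length ss) \<and> (i < length ss \<longrightarrow> subtree t (v @ [i]) = ss ! i)"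
    using assms
  proof (induction v arbitrary: t)
    case Nil
    then show ?case by (auto simp: Nil_in_vertices image_iff)
  next
    case (Cons j v)
    obtain ts where ts: "t = Node ts" by (cases t)
    then show ?case using Cons by auto
  qed
  then show "v @ [i] \<in> vertices t \<longleftrightarrow> i < length ss"
    and "i < length ss \<Longrightarrow> subtree t (v @ [i]) = ss ! i" by auto
qed

section \<open>Rank as a property of the fringe subtree\<close>

fun rank_ge :: "nat \<Rightarrow> plane_tree \<Rightarrow> bool" where
  "rank_ge 0 t = True"
| "rank_ge (Suc k) (Node ts) = (ts \<noteq> [] \<and> (\<forall>s\<in>set ts. rank_ge k s))"

text \<open>A shortest path from a non-leaf to a leaf is one step to a child followed by a shortest
  path from there.\<close>

lemma Suc_le_vertex_rank_iff:
  assumes v: "v \<in> vertices t"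
  shows "Suc k \<le> vertex_rank t v
    \<longleftrightarrow> \<not> is_leaf t v \<and> (\<forall>w. (v, w) \<in> child_rel t \<longrightarrow> k \<le> vertex_rank t w)"
proof (intro iffI conjI allI impI)
  assume le: "Suc k \<le> vertex_rank t v"
  have min: "vertex_rank t v \<le> j" if "is_leaf t w" "(v, w) \<in> child_rel t ^^ j" for w j
    unfolding vertex_rank_def by (rule Least_le) (use that in blast)
  show "\<not> is_leaf t v"
    using min[of v 0] le by auto
  fix w assume w: "(v, w) \<in> child_rel t"
  then obtain x where "is_leaf t x" "(w, x) \<in> child_rel t ^^ vertex_rank t w"
    using vertex_rank_attained[of w t] by (auto simp: child_rel_def)
  with w min[of x "Suc (vertex_rank t w)"] le show "k \<le> vertex_rank t w"
    using relpow_Suc_I2 by fastforce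
next
  assume *: "\<not> is_leaf t v \<and> (\<forall>w. (v, w) \<in> child_rel t \<longrightarrow> k \<le> vertex_rank t w)"
  obtain x where x: "is_leaf t x" "(v, x) \<in> child_rel t ^^ vertex_rank t v"
    using vertex_rank_attained[OF v] by blast
  show "Suc k \<le> vertex_rank t v"
  proof (cases "vertex_rank t v")
    case 0
    then show ?thesis using x * by auto
  next
    case (Suc j)
    with x obtain w where w: "(v, w) \<in> child_rel t" "(w, x) \<in> child_rel t ^^ j"
      by (metis relpow_Suc_D2)
    then have "vertex_rank t w \<le> j"
      unfolding vertex_rank_def using x(1) by (blast intro: Least_le)
    then show ?thesis using w * Suc by fastforce
  qed
qed

lemma le_vertex_rank_iff:
  assumes "v \<in> vertices t"
  shows "k \<le> vertex_rank t v \<longleftrightarrow> rank_ge k (subtree t v)"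
  using assms
proof (induction k arbitrary: v)
  case (Suc k)
  obtain ss where ss: "subtree t v = Node ss" by (cases "subtree t v")
  note snoc = subtree_snoc[OF Suc.prems ss]
  have child: "(v, w) \<in> child_rel t \<longleftrightarrow> (\<exists>i<length ss. w = v @ [i])" for w
    using Suc.prems snoc(1) by (auto simp: child_rel_def)
  have "k \<le> vertex_rank t (v @ [i]) \<longleftrightarrow> rank_ge k (ss ! i)" if "i < length ss" for i
    using Suc.IH[of "v @ [i]"] snoc that by simp
  then have "(\<forall>w. (v, w) \<in> child_rel t \<longrightarrow> k \<le> vertex_rank t w) \<longleftrightarrow> (\<forall>s\<in>set ss. rank_ge k s)"
    by (auto simp: child all_set_conv_all_nth)
  moreover have "is_leaf t v \<longleftrightarrow> ss = []"
    using Suc.prems by (auto simp: is_leaf_def child)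
  ultimately show ?case
    by (simp add: Suc_le_vertex_rank_iff[OF Suc.prems] ss)
qed simp

section \<open>Counting vertices by their fringe subtrees\<close>

definition fringe_count :: "(plane_tree \<Rightarrow> bool) \<Rightarrow> plane_tree \<Rightarrow> nat" where
  "fringe_count P t = card {v \<in> vertices t. P (subtree t v)}"

text \<open>Leaving out the root makes the count additive under \<open>graft t u\<close>: the root
  of \<open>t\<close> becomes a proper vertex, while the root of \<open>u\<close> becomes the root
  of the whole tree with a changed fringe subtree.\<close>

fun proper_fringe_count :: "(plane_tree \<Rightarrow> bool) \<Rightarrow> plane_tree \<Rightarrow> nat" where
  "proper_fringe_count P (Node ts) = (\<Sum>t\<leftarrow>ts. fringe_count P t)"

lemma fringe_count_eq: "fringe_count P t = of_bool (P t) + proper_fringe_count P t"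
proof -
  obtain ts where ts: "t = Node ts" by (cases t)
  let ?C = "\<lambda>i. (#) i ` {v \<in> vertices (ts ! i). P (subtree (ts ! i) v)}"
  have split: "{v \<in> vertices t. P (subtree t v)}
      = {v. v = [] \<and> P t} \<union> (\<Union>i\<in>{..<length ts}. ?C i)"
    by (auto simp: ts)
  have fin: "finite (?C i)" for i
    by (simp add: finite_vertices)
  have "fringe_count P t = card {v::nat list. v = [] \<and> P t} + card (\<Union>i\<in>{..<length ts}. ?C i)"
    unfolding fringe_count_def split by (rule card_Un_disjoint) (use fin in auto)
  also have "card {v::nat list. v = [] \<and> P t} = of_bool (P t)"
    by (cases "P t") auto
  also have "card (\<Union>i\<in>{..<length ts}. ?C i) = (\<Sum>i<length ts. card (?C i))"
    by (rule card_UN_disjoint) (use fin in auto)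
  also have "\<dots> = (\<Sum>i<length ts. fringe_count P (ts ! i))"
    by (simp add: card_image fringe_count_def)
  also have "\<dots> = proper_fringe_count P t"
    by (simp add: ts sum_list_sum_nth atLeast0LessThan)
  finally show ?thesis .
qed

lemma fringe_count_True: "fringe_count (\<lambda>_. True) t = tree_size t"
  by (simp add: fringe_count_def tree_size_def)

lemma proper_fringe_count_graft:
  "proper_fringe_count P (graft t u) = fringe_count P t + proper_fringe_count P u"
  by (cases u) simp

section \<open>The algebra of the generating functions\<close>

definition class_gf :: "(plane_tree \<Rightarrow> bool) \<Rightarrow> real fps" where
  "class_gf P = tree_gf (\<lambda>t. of_bool (P t))"

definition tree_series :: "real fps" where
  "tree_series = tree_gf (\<lambda>_. 1)"

lemma tree_series_eq: "tree_series = fps_X + tree_series * tree_series"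
  using tree_gf_graft_prod[of "\<lambda>_. 1" "\<lambda>_. 1" "\<lambda>_. 1"] by (simp add: tree_series_def)

text \<open>The series of the central binomial coefficients: constant term 1 and
  \<open>marked_series_rec\<close> determine them.\<close>

definition marked_series :: "real fps" where
  "marked_series = inverse (1 - 2 * tree_series)"

lemma tree_series_0 [simp]: "fps_nth tree_series 0 = 0"
  by (simp add: tree_series_def)

lemma marked_series_mult: "marked_series * (1 - 2 * tree_series) = 1"
  unfolding marked_series_def by (rule inverse_mult_eq_1) simp

lemma one_minus_2_tree_series_neq_0: "1 - 2 * tree_series \<noteq> 0"
proof
  assume "1 - 2 * tree_series = 0"
  then have "fps_nth (1 - 2 * tree_series) 0 = 0" by (simp only: fps_zero_nth)
  then show False by simp
qed

lemma marked_series_square: "marked_series * marked_series * (1 - 4 * fps_X) = 1"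
proof -
  have X: "fps_X = tree_series - tree_series * tree_series"
    using tree_series_eq by (simp add: algebra_simps)
  have "1 - 4 * fps_X = (1 - 2 * tree_series) * (1 - 2 * tree_series)"
    by (simp add: X algebra_simps)
  then have "marked_series * marked_series * (1 - 4 * fps_X)
      = (marked_series * (1 - 2 * tree_series)) * (marked_series * (1 - 2 * tree_series))"
    by (simp only: mult_ac)
  then show ?thesis by (simp add: marked_series_mult)
qed

lemma marked_series_nth_0: "fps_nth marked_series 0 = 1"
  using arg_cong[OF marked_series_mult, of "\<lambda>f. fps_nth f 0"] by simp

text \<open>Differentiating \<open>U * U * (1 - 4 * z) = 1\<close> and cancelling
  \<open>2 * U\<close> leaves the linear equation \<open>U' * (1 - 4 * z) = 2 * U\<close>, whose
  coefficients give the recurrence.\<close>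

lemma marked_series_rec:
  "real (Suc n) * fps_nth marked_series (Suc n) = (4 * real n + 2) * fps_nth marked_series n"
proof -
  let ?U = marked_series
  have "fps_deriv (?U * ?U * (1 - 4 * fps_X)) = 0"
    by (simp add: marked_series_square)
  then have "?U * (2 * (fps_deriv ?U * (1 - 4 * fps_X) - 2 * ?U)) = 0"
    by (simp add: algebra_simps)
  moreover have "?U \<noteq> 0"
    using marked_series_nth_0 by auto
  ultimately have "2 * (fps_deriv ?U * (1 - 4 * fps_X) - 2 * ?U) = 0"
    by (metis mult_eq_0_iff)
  then have "fps_deriv ?U * (1 - 4 * fps_X) - 2 * ?U = 0"
    by (metis mult_eq_0_iff zero_neq_numeral)
  then have "fps_deriv ?U - 4 * (fps_X * fps_deriv ?U) = 2 * ?U"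
    by (simp add: algebra_simps)
  from arg_cong[OF this, of "\<lambda>f. fps_nth f n"]
  show ?thesis by (cases n) (simp_all add: numeral_fps_const algebra_simps)
qed

lemma marked_series_pos: "fps_nth marked_series n > 0"
proof (induction n)
  case (Suc n)
  have "real (Suc n) * fps_nth marked_series (Suc n) > 0"
    unfolding marked_series_rec using Suc by simp
  then show ?case by (simp add: zero_less_mult_iff)
qed (simp add: marked_series_nth_0)

text \<open>With \<open>N\<close> and \<open>M\<close> the series of all and of proper fringe
  counts, \<open>N = P + M\<close> and \<open>M = N * T + T * M\<close>; eliminating
  \<open>M\<close> gives \<open>N * (1 - 2 * T) = P * (1 - T)\<close>.\<close>

lemma fringe_count_gf:
  "2 * tree_gf (\<lambda>t. real (fringe_count P t)) = class_gf P * (1 + marked_series)"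
proof -
  let ?N = "tree_gf (\<lambda>t. real (fringe_count P t))"
  let ?M = "tree_gf (\<lambda>t. real (proper_fringe_count P t))"
  let ?T = tree_series
  have "?N = class_gf P + ?M"
    unfolding class_gf_def tree_gf_add[symmetric] by (simp add: fringe_count_eq)
  moreover have "?M = ?N * ?T + ?T * ?M"
    unfolding tree_series_def
    by (subst tree_gf_graft[where a = "\<lambda>t. real (fringe_count P t)" and b = "\<lambda>_. 1"
          and c = "\<lambda>_. 1" and d = "\<lambda>t. real (proper_fringe_count P t)"])
       (simp_all add: proper_fringe_count_graft)
  ultimately have "?N * (1 - 2 * ?T) = class_gf P * (1 - ?T)"
    by algebra
  \<comment> \<open>Since \<open>U * (1 - 2 * T) = 1\<close>, the factor \<open>2 * (1 - T)\<close>
    equals \<open>(1 + U) * (1 - 2 * T)\<close>.\<close>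
  then have "(2 * ?N) * (1 - 2 * ?T) = (class_gf P * (1 + marked_series)) * (1 - 2 * ?T)"
    using marked_series_mult by algebra
  then show ?thesis using one_minus_2_tree_series_neq_0 by simp
qed

lemma tree_size_gf: "tree_gf (\<lambda>t. real (tree_size t)) = fps_X * marked_series"
proof -
  have "2 * tree_gf (\<lambda>t. real (tree_size t)) = tree_series * (1 + marked_series)"
    using fringe_count_gf[of "\<lambda>_. True"]
    by (simp add: class_gf_def tree_series_def fringe_count_True)
  moreover have "2 * (fps_X * marked_series) = tree_series * (1 + marked_series)"
    using tree_series_eq marked_series_mult by algebra
  ultimately have "2 * tree_gf (\<lambda>t. real (tree_size t)) = 2 * (fps_X * marked_series)" by simp
  then show ?thesis by (metis mult_cancel_left zero_neq_numeral)
qed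

lemma class_gf_rank_ge_Suc:
  "class_gf (rank_ge (Suc k)) = class_gf (rank_ge k) * (class_gf (rank_ge (Suc k)) + fps_X)"
proof -
  define q where "q u \<longleftrightarrow> (case u of Node ts \<Rightarrow> \<forall>s\<in>set ts. rank_ge k s)" for u
  have graft: "q (graft t u) \<longleftrightarrow> rank_ge k t \<and> q u"
    "rank_ge (Suc k) (graft t u) \<longleftrightarrow> rank_ge k t \<and> q u" for t u
    by (cases u; auto simp: q_def)+
  have "class_gf q = fps_X + class_gf (rank_ge k) * class_gf q"
    unfolding class_gf_def
    by (subst tree_gf_graft_prod[where a = "\<lambda>t. of_bool (rank_ge k t)" and b = "\<lambda>u. of_bool (q u)"])
       (simp_all only: graft of_bool_conj, simp add: q_def)
  moreover have "class_gf (rank_ge (Suc k)) = class_gf (rank_ge k) * class_gf q"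
    unfolding class_gf_def
    by (subst tree_gf_graft_prod[where a = "\<lambda>t. of_bool (rank_ge k t)" and b = "\<lambda>u. of_bool (q u)"])
       (simp_all only: graft of_bool_conj, simp)
  ultimately show ?thesis by (simp add: add.commute)
qed

section \<open>An exponential tail bound\<close>

fun leftmost_ge :: "nat \<Rightarrow> plane_tree \<Rightarrow> bool" where
  "leftmost_ge 0 t = True"
| "leftmost_ge (Suc k) (Node ts) = (ts \<noteq> [] \<and> leftmost_ge k (hd ts))"

lemma rank_ge_imp_leftmost_ge: "rank_ge k t \<Longrightarrow> leftmost_ge k t"
proof (induction k arbitrary: t)
  case (Suc k)
  then show ?case by (cases t) auto
qed simp

text \<open>Only the leftmost subtree \<open>t\<close> of \<open>graft t u\<close> is constrained,
  so each level contributes a free factor \<open>T\<close> for \<open>u\<close>.\<close>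

lemma class_gf_leftmost_ge: "class_gf (leftmost_ge k) = tree_series ^ Suc k"
proof (induction k)
  case 0
  then show ?case by (simp add: class_gf_def tree_series_def)
next
  case (Suc k)
  have "leftmost_ge (Suc k) (graft t u) \<longleftrightarrow> leftmost_ge k t" for t u
    by (cases u) simp
  then have "class_gf (leftmost_ge (Suc k)) = class_gf (leftmost_ge k) * tree_series"
    unfolding class_gf_def tree_series_def
    by (subst tree_gf_graft_prod[where a = "\<lambda>t. of_bool (leftmost_ge k t)" and b = "\<lambda>_. 1"])
       simp_all
  then show ?case using Suc by simp
qed

lemma fps_power_nonneg:
  fixes f :: "real fps"
  assumes "\<And>n. fps_nth f n \<ge> 0"
  shows "fps_nth (f ^ k) n \<ge> 0"
  by (induction k arbitrary: n) (auto simp: fps_mult_nth assms intro!: sum_nonneg)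

text \<open>
  The series \<open>A\<^sub>k\<close> of pairs with leftmost path of length at least \<open>k\<close> is \<open>z T\<^sup>k U\<close>, so
  \<open>A\<^sub>k - 2 A\<^bsub>k+1\<^esub> = z T\<^sup>k\<close> has nonnegative coefficients.
\<close>

lemma leftmost_fringe_count_le:
  "(\<Sum>t\<in>trees n. real (fringe_count (leftmost_ge k) t)) \<le> (\<Sum>t\<in>trees n. real (tree_size t)) / 2 ^ k"
proof (induction k)
  case 0
  then show ?case by (simp add: fringe_count_def tree_size_def)
next
  case (Suc k)
  define A where "A k = tree_gf (\<lambda>t. real (fringe_count (leftmost_ge k) t))" for k
  have A: "2 * A k = tree_series ^ Suc k * (1 + marked_series)" for k
    by (simp add: A_def fringe_count_gf class_gf_leftmost_ge)
  have "2 * (A k - 2 * A (Suc k)) = tree_series ^ k * ((tree_series - 2 * tree_series * tree_series) * (1 + marked_series))"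
    using A[of k] A[of "Suc k"] by (simp add: algebra_simps)
  also have "(tree_series - 2 * tree_series * tree_series) * (1 + marked_series) = 2 * fps_X"
    using tree_series_eq marked_series_mult by algebra
  finally have "2 * (A k - 2 * A (Suc k)) = 2 * (tree_series ^ k * fps_X)"
    by (simp add: algebra_simps)
  then have "A k - 2 * A (Suc k) = tree_series ^ k * fps_X"
    by (metis mult_cancel_left zero_neq_numeral)
  then have "fps_nth (A k - 2 * A (Suc k)) n \<ge> 0"
    using fps_power_nonneg[of tree_series k]
    by (simp add: tree_series_def tree_gf_nth)
  then have "2 * fps_nth (A (Suc k)) n \<le> fps_nth (A k) n"
    by simp
  then have "fps_nth (A (Suc k)) n \<le> fps_nth (A k) n / 2" by simp
  also have "\<dots> \<le> ((\<Sum>t\<in>trees n. real (tree_size t)) / 2 ^ k) / 2"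
    using Suc by (intro divide_right_mono) (simp_all add: A_def tree_gf_nth)
  finally show ?case by (simp add: A_def tree_gf_nth mult.commute)
qed

text \<open>Large rank makes every downward path long, the leftmost one included. The bound is
  uniform in \<open>n\<close> and later dominates the sum over ranks.\<close>

lemma rank_fringe_count_le:
  "(\<Sum>t\<in>trees n. real (fringe_count (rank_ge k) t)) \<le> (\<Sum>t\<in>trees n. real (tree_size t)) / 2 ^ k"
proof -
  have "fringe_count (rank_ge k) t \<le> fringe_count (leftmost_ge k) t" for t
    unfolding fringe_count_def
    by (rule card_mono) (auto simp: finite_vertices rank_ge_imp_leftmost_ge)
  then have "(\<Sum>t\<in>trees n. real (fringe_count (rank_ge k) t))
      \<le> (\<Sum>t\<in>trees n. real (fringe_count (leftmost_ge k) t))"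
    by (intro sum_mono) simp
  with leftmost_fringe_count_le show ?thesis by (rule order_trans[rotated])
qed

section \<open>Convergence of weighted sums\<close>

text \<open>A Fatou-type bound: a fixed finite part converges, and the remaining terms are
  nonnegative.\<close>

lemma eventually_less_weighted_sum:
  fixes p c :: "nat \<Rightarrow> real" and q :: "nat \<Rightarrow> nat \<Rightarrow> real"
  assumes p: "\<And>m. p m \<ge> 0" and q: "\<And>m n. q m n \<ge> 0"
    and lim: "\<And>m. q m \<longlonglongrightarrow> c m"
    and s: "s < (\<Sum>m\<le>N. p m * c m)"
  shows "eventually (\<lambda>n. s < (\<Sum>m\<le>n. p m * q m n)) sequentially"
proof -
  have "(\<lambda>n. \<Sum>m\<le>N. p m * q m n) \<longlonglongrightarrow> (\<Sum>m\<le>N. p m * c m)"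
    by (intro tendsto_intros lim)
  then have "eventually (\<lambda>n. s < (\<Sum>m\<le>N. p m * q m n)) sequentially"
    using s by (rule order_tendstoD)
  with eventually_ge_at_top[of N] show ?thesis
  proof eventually_elim
    case (elim n)
    have "(\<Sum>m\<le>N. p m * q m n) \<le> (\<Sum>m\<le>n. p m * q m n)"
      by (rule sum_mono2) (use elim p q in auto)
    with elim show ?case by linarith
  qed
qed

text \<open>A partial sum of the limits above 1 would force the total mass above 1 for large
  \<open>n\<close>.\<close>

lemma summable_weighted_limit:
  fixes t c :: "nat \<Rightarrow> real" and q :: "nat \<Rightarrow> nat \<Rightarrow> real"
  assumes t: "\<And>m. t m \<ge> 0" and q: "\<And>m n. q m n \<ge> 0"
    and lim: "\<And>m. q m \<longlonglongrightarrow> c m"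
    and total: "\<And>n. n > 0 \<Longrightarrow> (\<Sum>m\<le>n. t m * q m n) = 1"
  shows "summable (\<lambda>m. t m * c m)"
proof (rule bounded_imp_summable)
  show "0 \<le> t m * c m" for m
    using t q LIMSEQ_le_const[OF lim, of 0 m] by auto
  show "(\<Sum>m\<le>N. t m * c m) \<le> 1" for N
  proof (rule ccontr)
    assume "\<not> ?thesis"
    then have "eventually (\<lambda>n. 1 < (\<Sum>m\<le>n. t m * q m n)) sequentially"
      by (intro eventually_less_weighted_sum[where N = N, OF t q lim]) auto
    with eventually_gt_at_top[of 0] have "eventually (\<lambda>n::nat. False) sequentially"
      by eventually_elim (simp add: total)
    then show False by simp
  qed
qed

text \<open>
  A form of Scheffe's lemma: the lower bound for \<open>p\<close> and the one for \<open>t - p\<close>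
  together give the upper bound for \<open>p\<close>, because no mass is lost in the limit.
\<close>

lemma tendsto_weighted_sum:
  fixes t p c :: "nat \<Rightarrow> real" and q :: "nat \<Rightarrow> nat \<Rightarrow> real"
  assumes p: "\<And>m. 0 \<le> p m" "\<And>m. p m \<le> t m" and q: "\<And>m n. q m n \<ge> 0"
    and lim: "\<And>m. q m \<longlonglongrightarrow> c m"
    and total: "\<And>n. n > 0 \<Longrightarrow> (\<Sum>m\<le>n. t m * q m n) = 1"
    and t1: "(\<lambda>m. t m * c m) sums 1"
  shows "(\<lambda>n. \<Sum>m\<le>n. p m * q m n) \<longlonglongrightarrow> (\<Sum>m. p m * c m)"
proof -
  have c: "c m \<ge> 0" for m
    using q LIMSEQ_le_const[OF lim, of 0 m] by auto
  have sp: "summable (\<lambda>m. p m * c m)"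
    by (rule summable_comparison_test'[OF sums_summable[OF t1], of 0])
       (use p c in \<open>auto intro: mult_right_mono\<close>)
  have lower: "eventually (\<lambda>n. s < (\<Sum>m\<le>n. g m * q m n)) sequentially"
    if g: "\<And>m. g m \<ge> 0" and S: "(\<lambda>m. g m * c m) sums S" "s < S" for g s S
  proof -
    have "(\<lambda>N. \<Sum>m\<le>N. g m * c m) \<longlonglongrightarrow> S"
      using S(1) by (simp add: sums_def_le)
    then have "eventually (\<lambda>N. s < (\<Sum>m\<le>N. g m * c m)) sequentially"
      using S(2) by (rule order_tendstoD)
    then obtain N where "s < (\<Sum>m\<le>N. g m * c m)"
      by (auto simp: eventually_sequentially)
    then show ?thesis
      by (intro eventually_less_weighted_sum[OF g q lim])
  qed
  show ?thesis
  proof (rule order_tendstoI)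
    fix a assume "a < (\<Sum>m. p m * c m)"
    then show "eventually (\<lambda>n. a < (\<Sum>m\<le>n. p m * q m n)) sequentially"
      by (rule lower[OF p(1) summable_sums[OF sp]])
  next
    fix a assume a: "a > (\<Sum>m. p m * c m)"
    have "(\<lambda>m. (t m - p m) * c m) sums (1 - (\<Sum>m. p m * c m))"
      using sums_diff[OF t1 summable_sums[OF sp]] by (simp add: left_diff_distrib)
    then have "eventually (\<lambda>n. 1 - a < (\<Sum>m\<le>n. (t m - p m) * q m n)) sequentially"
      by (rule lower[rotated]) (use p a in auto)
    with eventually_gt_at_top[of 0]
    show "eventually (\<lambda>n. (\<Sum>m\<le>n. p m * q m n) < a) sequentially"
    proof eventually_elim
      case (elim n)
      then have "1 - a < 1 - (\<Sum>m\<le>n. p m * q m n)"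
        by (simp add: left_diff_distrib sum_subtractf total)
      then show ?case by simp
    qed
  qed
qed

section \<open>Evaluation at the singularity\<close>

text \<open>The ratio telescopes into \<open>j\<close> consecutive ratios, each tending to 1/4 by
  the recurrence.\<close>

lemma marked_series_ratio:
  "(\<lambda>n. fps_nth marked_series n / fps_nth marked_series (n + j)) \<longlonglongrightarrow> (1 / 4) ^ j"
proof (induction j)
  case 0
  have "fps_nth marked_series n \<noteq> 0" for n
    using marked_series_pos[of n] by simp
  then show ?case by simp
next
  case (Suc j)
  let ?u = "fps_nth marked_series"
  have step: "?u m / ?u (Suc m) = (real m + 1) / (4 * real m + 2)" for m
    using marked_series_rec[of m] marked_series_pos[of m] marked_series_pos[of "Suc m"]
    by (simp add: field_simps)
  have "(\<lambda>m. (real m + 1) / (4 * real m + 2)) \<longlonglongrightarrow> 1 / 4"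
    by real_asymp
  then have "(\<lambda>n. ?u (n + j) / ?u (Suc (n + j))) \<longlonglongrightarrow> 1 / 4"
    unfolding step by (rule LIMSEQ_ignore_initial_segment)
  from tendsto_mult[OF Suc this] show ?case
    using marked_series_pos by (simp add: less_imp_neq[symmetric] mult.commute)
qed

text \<open>For positive \<open>m\<close> and \<open>n\<close>, the probability that a random fringe
  subtree in size \<open>n\<close> is one prescribed tree of size \<open>m\<close>: the coefficient
  of \<open>(1 + U) / 2\<close> at \<open>n - m\<close> over that of \<open>z * U\<close> at
  \<open>n\<close>.\<close>

definition fringe_weight :: "nat \<Rightarrow> nat \<Rightarrow> real" where
  "fringe_weight m n =
     (if m \<le> n then fps_nth (1 + marked_series) (n - m) / (2 * fps_nth marked_series (n - 1)) else 0)"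

lemma fringe_weight_nonneg: "fringe_weight m n \<ge> 0"
  using marked_series_pos by (auto simp: fringe_weight_def less_imp_le intro!: divide_nonneg_pos)

lemma fringe_weight_tendsto: "fringe_weight m \<longlonglongrightarrow> 2 * (1 / 4) ^ m"
proof (rule LIMSEQ_offset)
  let ?u = "fps_nth marked_series"
  have nz: "?u n \<noteq> 0" for n
    using marked_series_pos[of n] by simp
  \<comment> \<open>The shift by \<open>Suc m\<close> keeps the index \<open>n - m\<close> positive,
    where the constant 1 in \<open>1 + U\<close> no longer contributes.\<close>
  have eq: "fringe_weight m (n + Suc m) = 1 / 2 * (inverse (?u n / ?u (n + 1)) * (?u n / ?u (n + m)))" for n
    using nz by (simp add: fringe_weight_def field_simps)
  have "(\<lambda>n. 1 / 2 * (inverse (?u n / ?u (n + 1)) * (?u n / ?u (n + m))))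
      \<longlonglongrightarrow> 1 / 2 * (inverse ((1 / 4) ^ 1) * (1 / 4) ^ m)"
    by (intro tendsto_intros marked_series_ratio) auto
  then show "(\<lambda>n. fringe_weight m (n + Suc m)) \<longlonglongrightarrow> 2 * (1 / 4) ^ m"
    unfolding eq by simp
qed

lemma sum_tree_size: "(\<Sum>t\<in>trees n. real (tree_size t)) = (if n = 0 then 0 else fps_nth marked_series (n - 1))"
  using arg_cong[OF tree_size_gf, of "\<lambda>f. fps_nth f n"] by (simp add: tree_gf_nth)

definition fringe_prob :: "(plane_tree \<Rightarrow> bool) \<Rightarrow> nat \<Rightarrow> real" where
  "fringe_prob P n =
     (\<Sum>t\<in>trees n. real (fringe_count P t)) / (\<Sum>t\<in>trees n. real (tree_size t))"

lemma fringe_prob_eq: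
  assumes "n > 0"
  shows "fringe_prob P n = (\<Sum>m\<le>n. fps_nth (class_gf P) m * fringe_weight m n)"
proof -
  have "2 * (\<Sum>t\<in>trees n. real (fringe_count P t))
      = (\<Sum>m\<le>n. fps_nth (class_gf P) m * fps_nth (1 + marked_series) (n - m))"
    using arg_cong[OF fringe_count_gf[of P], of "\<lambda>f. fps_nth f n"]
    by (simp add: tree_gf_nth fps_mult_nth[of "class_gf P"] atLeast0AtMost fps_numeral_nth)
  then have "(\<Sum>t\<in>trees n. real (fringe_count P t))
      = (\<Sum>m\<le>n. fps_nth (class_gf P) m * fps_nth (1 + marked_series) (n - m)) / 2" by simp
  then show ?thesis
    using assms
    by (simp add: fringe_prob_def sum_tree_size fringe_weight_def sum_divide_distrib)
qed

lemma class_gf_True: "class_gf (\<lambda>_. True) = tree_series"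
  by (simp add: class_gf_def tree_series_def)

lemma class_gf_nonneg: "fps_nth (class_gf P) m \<ge> 0"
  and class_gf_le: "fps_nth (class_gf P) m \<le> fps_nth tree_series m"
  by (auto simp: class_gf_def tree_series_def tree_gf_nth intro!: sum_nonneg sum_mono simp del: sum_constant)

lemma sum_tree_series_fringe_weight:
  assumes "n > 0"
  shows "(\<Sum>m\<le>n. fps_nth tree_series m * fringe_weight m n) = 1"
proof -
  have "fringe_prob (\<lambda>_. True) n = 1"
    using assms marked_series_pos[of "n - 1"]
    by (simp add: fringe_prob_def fringe_count_True sum_tree_size)
  then show ?thesis
    using fringe_prob_eq[OF assms, of "\<lambda>_. True"] by (simp add: class_gf_True)
qed

text \<open>Convergence at the singularity 1/4 comes from the total mass 1 of the weights for all
  trees; any class is then dominated by all trees.\<close>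

lemma class_gf_summable: "summable (\<lambda>m. fps_nth (class_gf P) m * (1 / 4) ^ m)"
proof -
  have "summable (\<lambda>m. fps_nth tree_series m * (2 * (1 / 4) ^ m))"
    by (rule summable_weighted_limit[where q = fringe_weight])
       (use class_gf_nonneg[of "\<lambda>_. True"] in
         \<open>auto simp: fringe_weight_nonneg fringe_weight_tendsto sum_tree_series_fringe_weight class_gf_True\<close>)
  then have "summable (\<lambda>m. 1 / 2 * (fps_nth tree_series m * (2 * (1 / 4) ^ m)))"
    by (rule summable_mult)
  then have "summable (\<lambda>m. fps_nth tree_series m * (1 / 4) ^ m)"
    by simp
  then show ?thesis
    by (rule summable_comparison_test'[of _ 0])
       (auto simp: class_gf_nonneg class_gf_le intro!: mult_right_mono)
qed

definition class_value :: "(plane_tree \<Rightarrow> bool) \<Rightarrow> real" where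
  "class_value P = (\<Sum>m. fps_nth (class_gf P) m * (1 / 4) ^ m)"

lemma class_value_sums: "(\<lambda>m. fps_nth (class_gf P) m * (1 / 4) ^ m) sums class_value P"
  unfolding class_value_def by (rule summable_sums) (rule class_gf_summable)

text \<open>Nonnegative coefficients make convergence at 1/4 absolute, so identities between the
  series can be evaluated there.\<close>

lemma class_value_mult_sums:
  "(\<lambda>m. fps_nth (class_gf P * class_gf Q) m * (1 / 4) ^ m) sums (class_value P * class_value Q)"
proof -
  let ?f = "\<lambda>P m. fps_nth (class_gf P) m * (1 / 4) ^ m"
  have "summable (\<lambda>m. norm (?f P m))" for P
    using class_gf_summable[of P] class_gf_nonneg[of P] by simp
  then have "(\<lambda>m. \<Sum>i\<le>m. ?f P i * ?f Q (m - i)) sums (class_value P * class_value Q)"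
    unfolding class_value_def by (intro Cauchy_product_sums)
  moreover have "(\<Sum>i\<le>m. ?f P i * ?f Q (m - i)) = fps_nth (class_gf P * class_gf Q) m * (1 / 4) ^ m" for m
    unfolding fps_mult_nth sum_distrib_right atLeast0AtMost
    by (intro sum.cong refl) (simp add: algebra_simps flip: power_add)
  ultimately show ?thesis by simp
qed

lemma fps_X_mult_sums:
  fixes f :: "real fps"
  assumes "(\<lambda>m. fps_nth f m * x ^ m) sums s"
  shows "(\<lambda>m. fps_nth (f * fps_X) m * x ^ m) sums (s * x)"
proof -
  have "(\<lambda>m. fps_nth (f * fps_X) (Suc m) * x ^ Suc m) sums (s * x)"
    using sums_mult2[OF assms, of x] by (simp add: mult_ac)
  then show ?thesis by (subst (asm) sums_Suc_iff) simp
qed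

text \<open>At \<open>z = 1/4\<close> the equation \<open>T = z + T * T\<close> has the double root
  1/2, so no branch has to be chosen.\<close>

lemma class_value_True: "class_value (\<lambda>_. True) = 1 / 2"
proof -
  let ?v = "class_value (\<lambda>_. True)"
  have "(\<lambda>m. fps_nth 1 m * (1 / 4) ^ m) sums (1::real)"
    using sums_single[of 0 "\<lambda>_. 1::real"]
    by (rule sums_cong[THEN iffD1, rotated]) simp
  from fps_X_mult_sums[OF this]
  have "(\<lambda>m. fps_nth fps_X m * (1 / 4) ^ m) sums (1 / 4 :: real)" by simp
  from sums_add[OF this class_value_mult_sums[of "\<lambda>_. True" "\<lambda>_. True"]]
  have "(\<lambda>m. fps_nth (fps_X + tree_series * tree_series) m * (1 / 4) ^ m) sums (1 / 4 + ?v * ?v)"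
    by (simp add: class_gf_True distrib_right)
  then have "?v = 1 / 4 + ?v * ?v"
    unfolding tree_series_eq[symmetric] unfolding class_gf_True[symmetric]
    by (rule sums_unique2[OF class_value_sums])
  then have "(?v - 1 / 2) * (?v - 1 / 2) = 0"
    by (simp add: algebra_simps)
  then show ?thesis by simp
qed

lemma class_value_rank_ge: "class_value (rank_ge k) = 3 / (2 * (4 ^ k + 2))"
proof (induction k)
  case 0
  have "rank_ge 0 = (\<lambda>_. True)" by auto
  then show ?case by (simp add: class_value_True)
next
  case (Suc k)
  let ?a = "class_value (rank_ge k)" and ?b = "class_value (rank_ge (Suc k))"
  have "(\<lambda>m. fps_nth (class_gf (rank_ge k) * (class_gf (rank_ge (Suc k)) + fps_X)) m * (1 / 4) ^ m)
      sums (?a * ?b + ?a * (1 / 4))"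
    using sums_add[OF class_value_mult_sums[of "rank_ge k" "rank_ge (Suc k)"]
        fps_X_mult_sums[OF class_value_sums[of "rank_ge k"]]]
    by (simp only: fps_add_nth distrib_left distrib_right)
  then have "?b = ?a * ?b + ?a * (1 / 4)"
    unfolding class_gf_rank_ge_Suc[symmetric]
    by (rule sums_unique2[OF class_value_sums])
  then have "?b * (1 - ?a) = ?a / 4"
    by (simp add: algebra_simps)
  moreover have "1 - ?a = (2 * 4 ^ k + 1) / (2 * (4 ^ k + 2))"
    by (simp add: Suc field_simps add_pos_pos[THEN less_imp_neq, symmetric])
  \<comment> \<open>The factor \<open>2 * 4 ^ k + 1\<close> cancels because
    \<open>4 ^ Suc k + 2\<close> is twice it.\<close>
  moreover have "?a / 4 = 3 / (2 * (4 ^ Suc k + 2)) * ((2 * 4 ^ k + 1) / (2 * (4 ^ k + 2)))"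
  proof -
    have "(4::real) ^ Suc k + 2 = 2 * (2 * 4 ^ k + 1)" by simp
    moreover have "(2::real) * 4 ^ k + 1 > 0" by (simp add: add_pos_pos)
    moreover have "(4::real) ^ k + 2 > 0" by (simp add: add_pos_pos)
    ultimately show ?thesis unfolding Suc by (simp only:) (simp add: divide_simps, simp add: algebra_simps)
  qed
  moreover have "(2 * 4 ^ k + 1) / (2 * (4 ^ k + 2)) \<noteq> (0::real)"
    by (simp add: add_pos_pos less_imp_neq[symmetric])
  ultimately show ?case by (metis mult_right_cancel)
qed

lemma fringe_prob_rank_ge_tendsto: "fringe_prob (rank_ge k) \<longlonglongrightarrow> 3 / (4 ^ k + 2)"
proof -
  have value2: "(\<lambda>m. fps_nth (class_gf P) m * (2 * (1 / 4) ^ m)) sums (2 * class_value P)" for P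
    using sums_mult[OF class_value_sums[of P], of 2] by (simp add: mult_ac)
  have "(\<lambda>n. \<Sum>m\<le>n. fps_nth (class_gf (rank_ge k)) m * fringe_weight m n)
      \<longlonglongrightarrow> (\<Sum>m. fps_nth (class_gf (rank_ge k)) m * (2 * (1 / 4) ^ m))"
    \<comment> \<open>All trees serve as the dominating class: their limiting mass is
      \<open>2 * (1 / 2) = 1\<close>.\<close>
    by (rule tendsto_weighted_sum[where t = "fps_nth tree_series"])
       (use value2[of "\<lambda>_. True"] in \<open>auto simp: class_gf_nonneg class_gf_le fringe_weight_nonneg
          fringe_weight_tendsto sum_tree_series_fringe_weight class_gf_True class_value_True\<close>)
  also have "(\<Sum>m. fps_nth (class_gf (rank_ge k)) m * (2 * (1 / 4) ^ m)) = 3 / (4 ^ k + 2)"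
  proof -
    have "2 * (3 / (2 * x)) = 3 / x" for x :: real by simp
    then show ?thesis
      using sums_unique[OF value2[of "rank_ge k"]] unfolding class_value_rank_ge by metis
  qed
  finally show ?thesis
    by (rule Lim_transform_eventually)
       (use eventually_gt_at_top[of 0] in eventually_elim, simp add: fringe_prob_eq)
qed

section \<open>The expected rank\<close>

lemma E_T_sums:
  assumes "n > 0"
  shows "(\<lambda>k. fringe_prob (rank_ge (Suc k)) n) sums E_T n"
proof -
  have inner: "measure_pmf.expectation (pmf_of_set (vertices t) \<bind> (\<lambda>v. return_pmf (vertex_rank t v))) real
      = (\<Sum>v\<in>vertices t. real (vertex_rank t v)) / real n" if "t \<in> trees n" for t
    using that Nil_in_vertices[of t]
    by (subst pmf_expectation_bind_pmf_of_set)
       (auto simp: finite_vertices trees_def tree_size_def sum_distrib_left divide_inverse mult.commute)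
  have fin: "finite (set_pmf (pmf_of_set (vertices t)))" for t
    by (metis Nil_in_vertices empty_iff finite_vertices set_pmf_of_set)
  have "E_T n = (\<Sum>t\<in>trees n. measure_pmf.expectation
      (pmf_of_set (vertices t) \<bind> (\<lambda>v. return_pmf (vertex_rank t v))) real /\<^sub>R real (card (trees n)))"
    unfolding E_T_def random_rank_def
    by (subst pmf_expectation_bind_pmf_of_set)
       (auto simp: trees_nonempty assms finite_trees fin)
  \<comment> \<open>Every tree here has \<open>n\<close> vertices, so the two successive uniform
    choices amount to one uniform choice among all pairs.\<close>
  also have "\<dots> = (\<Sum>t\<in>trees n. \<Sum>v\<in>vertices t. real (vertex_rank t v)) / (\<Sum>t\<in>trees n. real (tree_size t))"
    by (simp add: inner trees_def sum_distrib_left sum_distrib_right divide_inverse mult_ac)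
  finally have E: "E_T n = (\<Sum>t\<in>trees n. \<Sum>v\<in>vertices t. real (vertex_rank t v))
      / (\<Sum>t\<in>trees n. real (tree_size t))" .
  have count: "real (fringe_count (rank_ge k) t) = (\<Sum>v\<in>vertices t. of_bool (k \<le> vertex_rank t v))" for k t
  proof -
    have "{v \<in> vertices t. rank_ge k (subtree t v)} = vertices t \<inter> {v. k \<le> vertex_rank t v}"
      by (auto simp: le_vertex_rank_iff)
    then show ?thesis
      by (simp add: fringe_count_def of_bool_def sum.If_cases finite_vertices)
  qed
  \<comment> \<open>The tail-sum formula for expectations: a rank \<open>r\<close> is the number of
    \<open>k\<close> with \<open>Suc k \<le> r\<close>.\<close>
  have "(\<lambda>k. of_bool (Suc k \<le> r) :: real) sums real r" for r
    using sums_finite[of "{..<r}" "\<lambda>k. of_bool (Suc k \<le> r) :: real"] by auto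
  then show ?thesis
    unfolding E fringe_prob_def count by (intro sums_divide sums_sum)
qed

lemma E_T_tendsto: "E_T \<longlonglongrightarrow> (\<Sum>k. 3 / (4 ^ Suc k + 2))"
proof -
  \<comment> \<open>For \<open>n = 0\<close> the quotient is 0 / 0, which evaluates to 0, so the
    bound holds for all \<open>n\<close>.\<close>
  have bound: "norm (fringe_prob (rank_ge (Suc k)) n) \<le> (1 / 2) ^ Suc k" for k n
  proof (cases "n = 0")
    case False
    then have "(\<Sum>t\<in>trees n. real (tree_size t)) > 0"
      by (simp add: sum_tree_size marked_series_pos)
    then show ?thesis
      using rank_fringe_count_le[of "Suc k" n]
      by (simp add: fringe_prob_def divide_simps sum_nonneg mult_ac)
  qed (simp add: fringe_prob_def)
  have "(\<lambda>n. \<Sum>k. fringe_prob (rank_ge (Suc k)) n) \<longlonglongrightarrow> (\<Sum>k. 3 / (4 ^ Suc k + 2))"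
  proof (rule tannerys_theorem[THEN conjunct2, THEN conjunct2])
    show "eventually (\<lambda>(k, n). norm (fringe_prob (rank_ge (Suc k)) n) \<le> (1 / 2) ^ Suc k)
        (at_top \<times>\<^sub>F sequentially)"
      by (rule always_eventually) (use bound in \<open>simp only: split_paired_All prod.case, blast\<close>)
    show "summable (\<lambda>k. (1 / 2) ^ Suc k :: real)"
      by (subst summable_Suc_iff) (simp add: summable_geometric)
  qed (rule fringe_prob_rank_ge_tendsto, simp)
  then show ?thesis
    by (rule Lim_transform_eventually)
       (use eventually_gt_at_top[of 0] in eventually_elim, simp add: sums_unique[OF E_T_sums])
qed

lemma rank_series_bounds:
  "\<bar>(\<Sum>k. 3 / (4 ^ Suc k + 2)) - (0.727649 :: real)\<bar> < 0.0000005"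
proof -
  define f :: "nat \<Rightarrow> real" where "f k = 3 / (4 ^ Suc k + 2)" for k
  \<comment> \<open>Dropping the 2 in the denominators bounds the tail after 12 terms by a geometric
    series with sum \<open>1 / 4 ^ 12\<close>, below 6e-8.\<close>
  have geo: "(\<lambda>k. 3 / 4 ^ 13 * (1 / 4) ^ k :: real) sums (3 / 4 ^ 13 * (1 / (1 - 1 / 4)))"
    by (intro sums_mult geometric_sums) simp
  have le: "f (k + 12) \<le> 3 / 4 ^ 13 * (1 / 4) ^ k" for k
  proof -
    have "f (k + 12) \<le> 3 / 4 ^ Suc (k + 12)"
      unfolding f_def by (intro divide_left_mono) (auto intro!: add_pos_pos mult_pos_pos simp del: power_Suc)
    then show ?thesis by (simp add: power_add power_divide)
  qed
  have pos: "f k \<ge> 0" for k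
    by (simp add: f_def)
  have sf: "summable (\<lambda>k. f (k + 12))"
    by (rule summable_comparison_test'[OF sums_summable[OF geo], of 0]) (use le pos in auto)
  have "(\<Sum>k. f (k + 12)) \<le> 3 / 4 ^ 13 * (1 / (1 - 1 / 4))"
    using suminf_le[OF le sf sums_summable[OF geo]] sums_unique[OF geo] by simp
  moreover have "(\<Sum>k. f (k + 12)) \<ge> 0"
    by (rule suminf_nonneg[OF sf]) (use pos in auto)
  moreover have "suminf f = (\<Sum>k. f (k + 12)) + (\<Sum>k<12. f k)"
    using sf by (intro suminf_split_initial_segment) (simp add: summable_iff_shift)
  moreover have "(\<Sum>k<12. f k) \<ge> 0.72764921" "(\<Sum>k<12. f k) \<le> 0.72764928"
    by (simp_all add: f_def eval_nat_numeral lessThan_Suc)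
  ultimately show ?thesis
    by (simp add: f_def[abs_def] abs_less_iff)
qed

theorem theorem4p2:
  shows "E_T \<sim>[at_top] (\<lambda>_. \<Sum>k. 3 / (4 ^ Suc k + 2))
    \<and> \<bar>(\<Sum>k. 3 / (4 ^ Suc k + 2)) - (0.727649 :: real)\<bar> < 0.0000005"
proof
  \<comment> \<open>Convergence to a constant yields asymptotic equivalence once the constant is
    nonzero; the numerical estimate ensures this.\<close>
  have "(\<Sum>k. 3 / (4 ^ Suc k + 2)) \<noteq> (0::real)"
    using rank_series_bounds by (auto simp del: power_Suc)
  with E_T_tendsto show "E_T \<sim>[at_top] (\<lambda>_. \<Sum>k. 3 / (4 ^ Suc k + 2))"
    by (rule tendsto_imp_asymp_equiv_const)
  show "\<bar>(\<Sum>k. 3 / (4 ^ Suc k + 2)) - (0.727649 :: real)\<bar> < 0.0000005"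
    by (rule rank_series_bounds)
qed

end
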